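(* Let $\mathbb F$ be an algebraically closed field and let $q\in\mathbb F$ be nonzero and not a root of unity. Let $V$ denote an evaluation module for $\boxtimes_q$, with diameter $d$ and evaluation parameter $t$, and let $\Upsilon=(q^{d+1}+q^{-d-1})I$ on $V$. Then $x_{01},x_{23}$ satisfy the following on $V$: $$x_{01}^2x_{23}-(q^2+q^{-2})x_{01}x_{23}x_{01}+x_{23}x_{01}^2=-(q-q^{-1})^2(1+t^{-1}\Upsilon)x_{01}+(q-q^{-1})(q^2-q^{-2})t^{-1},$$ $$x_{23}^2x_{01}-(q^2+q^{-2})x_{23}x_{01}x_{23}+x_{01}x_{23}^2=-(q-q^{-1})^2(1+t^{-1}\Upsilon)x_{23}+(q-q^{-1})(q^2-q^{-2})t^{-1}.$$ Moreover $x_{12},x_{30}$ satisfy the following on $V$: $$x_{12}^2x_{30}-(q^2+q^{-2})x_{12}x_{30}x_{12}+x_{30}x_{12}^2=-(q-q^{-1})^2(1+t\Upsilon)x_{12}+(q-q^{-1})(q^2-q^{-2})t,$$ $$x_{30}^2x_{12}-(q^2+q^{-2})x_{30}x_{12}x_{30}+x_{12}x_{30}^2=-(q-q^{-1})^2(1+t\Upsilon)x_{30}+(q-q^{-1})(q^2-q^{-2})t.$$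
   Context: Algebras are associative with 1. $[n]_q=(q^n-q^{-n})/(q-q^{-1})$ and $\mathbb Z_4=\mathbb Z/4\mathbb Z$. Scalars in operator identities stand for scalar multiples of the identity. The $q$-tetrahedron algebra $\boxtimes_q$ is the $\mathbb F$-algebra with generators (called the standard generators) $\{x_{ij}\mid i,j\in\mathbb Z_4,\ j-i=1\text{ or }j-i=2\}$ and relations: (i) $x_{ij}x_{ji}=1$ if $j-i=2$; (ii) $\frac{qx_{ij}x_{jk}-q^{-1}x_{jk}x_{ij}}{q-q^{-1}}=1$ if $(j-i,k-j)$ is one of $(1,1),(1,2),(2,1)$; (iii) $x_{ij}^3x_{k\ell}-[3]_qx_{ij}^2x_{k\ell}x_{ij}+[3]_qx_{ij}x_{k\ell}x_{ij}^2-x_{k\ell}x_{ij}^3=0$ if $j-i=k-j=\ell-k=1$. Known fact: on a finite-dimensional irreducible $\boxtimes_q$-module $V$ there are $d\in\mathbb N$ (the diameter) and $\varepsilon\in\{1,-1\}$ (the type) such that each standard generator is diagonalizable with set of distinct eigenvalues $\{\varepsilon q^{d-2n}\mid 0\le n\le d\}$. If $V$ has type 1, the sequence of dimensions of the eigenspaces of $x_{ij}$ for eigenvalues $q^{d},q^{d-2},\dots,q^{-d}$ does not depend on $x_{ij}$; it is called the shape of $V$. The trivial $\boxtimes_q$-module is the one-dimensional module on which every standard generator acts as the identity. An evaluation module for $\boxtimes_q$ is a nontrivial finite-dimensional irreducible $\boxtimes_q$-module of type 1 and shape $(1,1,\dots,1)$ (so $d\ge1$ and $\dim V=d+1$). Matrices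 in ${\rm Mat}_{d+1}(\mathbb F)$ have rows and columns indexed by $0,\dots,d$; $M$ represents $A$ with respect to a basis $\{v_n\}_{n=0}^d$ when $Av_n=\sum_i M_{in}v_i$. Entries not mentioned below are $0$. A subscript $q^{-1}$ means that $q$ is replaced by $q^{-1}$ in the definition (and similarly $t^{-1}$ as argument). - $Z$: $(i,j)$-entry $\delta_{i+j,d}$. - $K_q$: diagonal, $(i,i)$-entry $q^{d-2i}$. - $E_q$: $(i,i)$-entry $q^{2i-d}$; $(i-1,i)$-entry $q^d-q^{2i-2-d}$. - $G_q(t)$: $(i,i)$-entry $q^{2i-d}$; $(i-1,i)$-entry $(q^d-q^{2i-2-d})(1-tq^{d-2i+1})$. - $L_q(t)$: $(i,i)$-entry $q^{2i-d}$; $(i-1,i)$-entry $(q^d-q^{2i-2-d})(1-tq^{d-2i+1})^{-1}$. - $S_q(t)$: $(i-1,i)$-entry $(q^d-q^{2i-d-2})(1-tq^{2i-d-1})$; $(i,i-1)$-entry $(q^{2i-d}-q^{-d})q^{2i-d-1}t$; $(i,i)$-entry $q^d-(q^{2i-d}-q^{-d})q^{2i-d-1}t-(q^d-q^{2i-d})(1-tq^{2i-d+1})$. For an integer $d\ge1$ and a nonzero $t\in\mathbb F$ not among $\{q^{d-2n+1}\}_{n=1}^d$, $\mathbf V_d(t)$ is the evaluation module for $\boxtimes_q$ having a basis with respect to which the standard generators are represented by: $x_{01}: ZS_{q^{-1}}(t^{-1})Z$, $x_{12}: E_q$, $x_{23}: K_q$, $x_{30}: ZG_{q^{-1}}(t)Z$,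 $x_{02}: L_q(t)$, $x_{13}: (ZE_{q^{-1}}Z)^{-1}$, $x_{20}: (L_q(t))^{-1}$, $x_{31}: ZE_{q^{-1}}Z$. Every evaluation module $V$ of diameter $d$ is isomorphic to $\mathbf V_d(t)$ for a unique such $t$, called the evaluation parameter of $V$. *)

theory Defs
  imports
    "HOL-Library.Poly_Mapping"
    "HOL-Library.Numeral_Type"
    "HOL-Computational_Algebra.Polynomial"
    "HOL-Algebra.QuotRing"
    "HOL-Algebra.Algebraic_Closure_Type"
    "Jordan_Normal_Form.Gauss_Jordan_Elimination"
begin

section \<open>The q-tetrahedron algebra\<close>

text \<open>The type \<open>4\<close> of \<^theory>\<open>HOL-Library.Numeral_Type\<close> is the ring of integers modulo 4.\<close>

typedef std_gen = "{(i, j). j - i = 1 \<or> j - i = 2} :: (4 \<times> 4) set"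
  by (rule exI[of _ "(0, 1)"]) simp

text \<open>Words under concatenation, written additively: the convolution product of
  \<^theory>\<open>HOL-Library.Poly_Mapping\<close> then makes the finitely supported functions on words the
  free associative unital algebra.\<close>

datatype 'g word = Word (letters: "'g list")

instantiation word :: (type) monoid_add
begin

definition zero_word :: "'a word"
  where "zero_word = Word []"

definition plus_word :: "'a word \<Rightarrow> 'a word \<Rightarrow> 'a word"
  where "plus_word u w = Word (letters u @ letters w)"

instance
  by standard (simp_all add: zero_word_def plus_word_def)

end

type_synonym 'f free_alg = "std_gen word \<Rightarrow>\<^sub>0 'f"

definition free_scalar :: "'f::field \<Rightarrow> 'f free_alg"
  where "free_scalar c = Poly_Mapping.single 0 c"

text \<open>Only meaningful when \<open>j - i\<close> is 1 or 2.\<close>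

definition free_gen :: "4 \<Rightarrow> 4 \<Rightarrow> ('f::field) free_alg"
  where "free_gen i j = Poly_Mapping.single (Word [Abs_std_gen (i, j)]) 1"

definition qint :: "'f::field \<Rightarrow> nat \<Rightarrow> 'f"
  where "qint q n = (q ^ n - inverse q ^ n) / (q - inverse q)"

definition tet_relators :: "'f::field \<Rightarrow> 'f free_alg set"
  where "tet_relators q =
    {free_gen i j * free_gen j i - 1 | i j. j - i = 2} \<union>
    {free_scalar (inverse (q - inverse q)) *
       (free_scalar q * free_gen i j * free_gen j k
        - free_scalar (inverse q) * free_gen j k * free_gen i j) - 1
      | i j k. (j - i, k - j) \<in> {(1, 1), (1, 2), (2, 1)}} \<union>
    {free_gen i j ^ 3 * free_gen k l
      - free_scalar (qint q 3) * free_gen i j ^ 2 * free_gen k l * free_gen i j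
      + free_scalar (qint q 3) * free_gen i j * free_gen k l * free_gen i j ^ 2
      - free_gen k l * free_gen i j ^ 3
      | i j k l. j - i = 1 \<and> k - j = 1 \<and> l - k = 1}"

abbreviation free_ring :: "('f::field) free_alg ring"
  where "free_ring \<equiv> ring_of_type_algebra"

definition tet_ideal :: "'f::field \<Rightarrow> 'f free_alg set"
  where "tet_ideal q = genideal free_ring (tet_relators q)"

definition tet_alg :: "'f::field \<Rightarrow> 'f free_alg set ring"
  where "tet_alg q = free_ring Quot tet_ideal q"

definition tet_class :: "'f::field \<Rightarrow> 'f free_alg \<Rightarrow> 'f free_alg set"
  where "tet_class q a = tet_ideal q +>\<^bsub>free_ring\<^esub> a"

definition std :: "'f::field \<Rightarrow> 4 \<Rightarrow> 4 \<Rightarrow> 'f free_alg set"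
  where "std q i j = tet_class q (free_gen i j)"


section \<open>The matrices\<close>

text \<open>Rows and columns are indexed from 0 to \<open>d\<close>. Replacing \<open>q\<close> by its inverse in a matrix is done by
  passing \<open>inverse q\<close>. In a superdiagonal entry \<open>(i - 1, i)\<close> the index \<open>i\<close> is the column; in a
  subdiagonal entry \<open>(i, i - 1)\<close> it is the row.\<close>

definition Z_mat :: "nat \<Rightarrow> 'f::field mat"
  where "Z_mat d = mat (d + 1) (d + 1) (\<lambda>(r, c). if r + c = d then 1 else 0)"

definition K_mat :: "nat \<Rightarrow> 'f::field \<Rightarrow> 'f mat"
  where "K_mat d q = mat (d + 1) (d + 1)
    (\<lambda>(r, c). if r = c then q powi (int d - 2 * int r) else 0)"

definition E_mat :: "nat \<Rightarrow> 'f::field \<Rightarrow> 'f mat"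
  where "E_mat d q = mat (d + 1) (d + 1)
    (\<lambda>(r, c). if r = c then q powi (2 * int r - int d)
       else if c = r + 1 then q powi (int d) - q powi (2 * int c - 2 - int d)
       else 0)"

definition G_mat :: "nat \<Rightarrow> 'f::field \<Rightarrow> 'f \<Rightarrow> 'f mat"
  where "G_mat d q t = mat (d + 1) (d + 1)
    (\<lambda>(r, c). if r = c then q powi (2 * int r - int d)
       else if c = r + 1 then
         (q powi (int d) - q powi (2 * int c - 2 - int d)) * (1 - t * q powi (int d - 2 * int c + 1))
       else 0)"

definition L_mat :: "nat \<Rightarrow> 'f::field \<Rightarrow> 'f \<Rightarrow> 'f mat"
  where "L_mat d q t = mat (d + 1) (d + 1)
    (\<lambda>(r, c). if r = c then q powi (2 * int r - int d)
       else if c = r + 1 then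
         (q powi (int d) - q powi (2 * int c - 2 - int d)) * inverse (1 - t * q powi (int d - 2 * int c + 1))
       else 0)"

definition S_mat :: "nat \<Rightarrow> 'f::field \<Rightarrow> 'f \<Rightarrow> 'f mat"
  where "S_mat d q t = mat (d + 1) (d + 1)
    (\<lambda>(r, c). if r = c then
         q powi (int d)
         - (q powi (2 * int r - int d) - q powi (- int d)) * q powi (2 * int r - int d - 1) * t
         - (q powi (int d) - q powi (2 * int r - int d)) * (1 - t * q powi (2 * int r - int d + 1))
       else if c = r + 1 then
         (q powi (int d) - q powi (2 * int c - int d - 2)) * (1 - t * q powi (2 * int c - int d - 1))
       else if r = c + 1 then
         (q powi (2 * int r - int d) - q powi (- int d)) * q powi (2 * int r - int d - 1) * t
       else 0)"

definition mat_inv :: "'f::field mat \<Rightarrow> 'f mat"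
  where "mat_inv A = the (mat_inverse A)"


section \<open>Modules\<close>

text \<open>Left modules for the q-tetrahedron algebra: the module is the whole type \<open>'v\<close>, and an element
  \<open>a\<close> of the algebra acts as \<open>act a\<close>. The last assumption makes the vector space structure on \<open>'v\<close> the
  one coming from the scalars of the algebra.\<close>

locale tet_module = vector_space scale
  for scale :: "'f::field \<Rightarrow> 'v::ab_group_add \<Rightarrow> 'v" +
  fixes q :: 'f
    and act :: "'f free_alg set \<Rightarrow> 'v \<Rightarrow> 'v"
  assumes act_vec_add: "a \<in> carrier (tet_alg q) \<Longrightarrow> act a (v + w) = act a v + act a w"
    and act_add: "a \<in> carrier (tet_alg q) \<Longrightarrow> b \<in> carrier (tet_alg q) \<Longrightarrow>
      act (a \<oplus>\<^bsub>tet_alg q\<^esub> b) v = act a v + act b v"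
    and act_mult: "a \<in> carrier (tet_alg q) \<Longrightarrow> b \<in> carrier (tet_alg q) \<Longrightarrow>
      act (a \<otimes>\<^bsub>tet_alg q\<^esub> b) v = act a (act b v)"
    and act_scalar: "act (tet_class q (free_scalar c)) v = scale c v"
begin

definition gen_act :: "4 \<Rightarrow> 4 \<Rightarrow> 'v \<Rightarrow> 'v"
  where "gen_act i j = act (std q i j)"

definition finite_dim :: bool
  where "finite_dim \<longleftrightarrow> (\<exists>B. finite B \<and> span B = UNIV)"

definition submodule :: "'v set \<Rightarrow> bool"
  where "submodule W \<longleftrightarrow> subspace W \<and> (\<forall>a \<in> carrier (tet_alg q). \<forall>w \<in> W. act a w \<in> W)"

definition irreducible_module :: bool
  where "irreducible_module \<longleftrightarrow>
    (UNIV :: 'v set) \<noteq> {0} \<and> (\<forall>W. submodule W \<longrightarrow> W = {0} \<or> W = UNIV)"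

definition trivial_module :: bool
  where "trivial_module \<longleftrightarrow>
    dim (UNIV :: 'v set) = 1 \<and> (\<forall>i j. j - i \<in> {1, 2} \<longrightarrow> (\<forall>v. gen_act i j v = v))"

definition eigenspace :: "('v \<Rightarrow> 'v) \<Rightarrow> 'f \<Rightarrow> 'v set"
  where "eigenspace f c = {v. f v = scale c v}"

definition eigenvalues :: "('v \<Rightarrow> 'v) \<Rightarrow> 'f set"
  where "eigenvalues f = {c. eigenspace f c \<noteq> {0}}"

definition diagonalizable :: "('v \<Rightarrow> 'v) \<Rightarrow> bool"
  where "diagonalizable f \<longleftrightarrow>
    (\<exists>B. independent B \<and> span B = UNIV \<and> (\<forall>v \<in> B. \<exists>c. f v = scale c v))"

definition has_type_diameter :: "'f \<Rightarrow> nat \<Rightarrow> bool"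
  where "has_type_diameter \<epsilon> d \<longleftrightarrow> \<epsilon> \<in> {1, -1} \<and>
    (\<forall>i j. j - i \<in> {1, 2} \<longrightarrow> diagonalizable (gen_act i j) \<and>
      eigenvalues (gen_act i j) = {\<epsilon> * q powi (int d - 2 * int n) | n. n \<le> d})"

definition has_shape :: "nat list \<Rightarrow> bool"
  where "has_shape s \<longleftrightarrow> (\<exists>d. has_type_diameter 1 d \<and>
    (\<forall>i j. j - i \<in> {1, 2} \<longrightarrow>
      s = map (\<lambda>n. dim (eigenspace (gen_act i j) (q powi (int d - 2 * int n)))) [0..<d + 1]))"

definition evaluation_module :: "nat \<Rightarrow> bool"
  where "evaluation_module d \<longleftrightarrow> finite_dim \<and> irreducible_module \<and> \<not> trivial_module \<and>
    has_type_diameter 1 d \<and> has_shape (replicate (d + 1) 1)"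

definition is_basis :: "nat \<Rightarrow> (nat \<Rightarrow> 'v) \<Rightarrow> bool"
  where "is_basis d v \<longleftrightarrow> inj_on v {..d} \<and> independent (v ` {..d}) \<and> span (v ` {..d}) = UNIV"

definition represents :: "nat \<Rightarrow> (nat \<Rightarrow> 'v) \<Rightarrow> 'f mat \<Rightarrow> ('v \<Rightarrow> 'v) \<Rightarrow> bool"
  where "represents d v M f \<longleftrightarrow> (\<forall>n \<le> d. f (v n) = (\<Sum>i \<le> d. scale (M $$ (i, n)) (v i)))"

text \<open>Being isomorphic to the evaluation module \<open>V\<^sub>d(t)\<close>: that module is specified, up to isomorphism,
  by the existence of a basis in which the standard generators have the matrices below.\<close>

definition iso_V :: "nat \<Rightarrow> 'f \<Rightarrow> bool"
  where "iso_V d t \<longleftrightarrow> (\<exists>v. is_basis d v \<and>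
    represents d v (Z_mat d * S_mat d (inverse q) (inverse t) * Z_mat d) (gen_act 0 1) \<and>
    represents d v (E_mat d q) (gen_act 1 2) \<and>
    represents d v (K_mat d q) (gen_act 2 3) \<and>
    represents d v (Z_mat d * G_mat d (inverse q) t * Z_mat d) (gen_act 3 0) \<and>
    represents d v (L_mat d q t) (gen_act 0 2) \<and>
    represents d v (mat_inv (Z_mat d * E_mat d (inverse q) * Z_mat d)) (gen_act 1 3) \<and>
    represents d v (mat_inv (L_mat d q t)) (gen_act 2 0) \<and>
    represents d v (Z_mat d * E_mat d (inverse q) * Z_mat d) (gen_act 3 1))"

definition evaluation_parameter :: "nat \<Rightarrow> 'f \<Rightarrow> bool"
  where "evaluation_parameter d t \<longleftrightarrow> t \<noteq> 0 \<and>
    t \<notin> {q powi (int d - 2 * int n + 1) | n. 1 \<le> n \<and> n \<le> d} \<and> iso_V d t"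

end

end

theory Submission
  imports Defs
begin

text \<open>
  In the defining basis \<open>v\<^sub>0, \<dots>, v\<^sub>d\<close> of the evaluation module the four generators in question are
  tridiagonal: \<open>x\<^sub>2\<^sub>3\<close> is diagonal, \<open>x\<^sub>1\<^sub>2\<close> and \<open>x\<^sub>3\<^sub>0\<close> are upper and lower bidiagonal with the same
  diagonal, and \<open>x\<^sub>0\<^sub>1\<close> is tridiagonal. Each of the four relations is therefore a comparison of
  coefficients of \<open>v\<^sub>n\<^sub>-\<^sub>2, \<dots>, v\<^sub>n\<^sub>+\<^sub>2\<close> after applying both sides to \<open>v\<^sub>n\<close>.

  Two observations keep this comparison short. First, put \<open>v\<^sub>n = 0\<close> for the other integers \<open>n\<close>. The
  formulas for the matrix entries, read outside their range, give the coefficient 0 both from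
  \<open>v\<^sub>d\<^sub>+\<^sub>1\<close> down to \<open>v\<^sub>d\<close> and from \<open>v\<^sub>-\<^sub>1\<close> up to \<open>v\<^sub>0\<close>. So one formula describes a generator at every integer
  \<open>n\<close> (\<open>tridiagonal_action\<close>), and the ends of the basis need no separate treatment. Second, the
  coefficients depend on \<open>n\<close> only through \<open>\<theta>\<^sub>n = q\<^bsup>2n-d\<^esup>\<close>, and \<open>\<theta>\<^sub>n\<^sub>+\<^sub>1 = q\<^sup>2 \<theta>\<^sub>n\<close>, so that each comparison
  is a single identity of rational functions in \<open>q\<close>, \<open>q\<^sup>d\<close>, \<open>t\<close> and \<open>\<theta>\<^sub>n\<close>.

  The coefficients two steps off the diagonal cancel because a geometric sequence of ratio \<open>q\<^sup>2\<close>
  satisfies \<open>\<theta>\<^sub>n\<^sub>+\<^sub>1 + \<theta>\<^sub>n\<^sub>-\<^sub>1 = (q\<^sup>2 + q\<^sup>-\<^sup>2) \<theta>\<^sub>n\<close>. The diagonal of \<open>x\<^sub>0\<^sub>1\<close>, complicated as it looks in the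
  definition of \<open>S\<close>, equals \<open>(1 + t\<^sup>-\<^sup>1 \<Upsilon>) \<theta>\<^sub>n - t\<^sup>-\<^sup>1 (q + q\<^sup>-\<^sup>1) \<theta>\<^sub>n\<^sup>2\<close>; this is where \<open>\<Upsilon>\<close> and the two scalars
  on the right of the relations for \<open>x\<^sub>0\<^sub>1, x\<^sub>2\<^sub>3\<close> come from. The two computations are
  \<open>askey_wilson_geometric_tridiagonal\<close> (for \<open>x\<^sub>0\<^sub>1, x\<^sub>2\<^sub>3\<close>) and \<open>askey_wilson_geometric_bidiagonal\<close> (for \<open>x\<^sub>1\<^sub>2, x\<^sub>3\<^sub>0\<close>).
  The latter serves both orders of the pair, since replacing \<open>n\<close> by \<open>-n\<close> and \<open>q\<close> by \<open>q\<^sup>-\<^sup>1\<close> exchanges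
  the two bidiagonal shapes.
\<close>

section \<open>Generators act linearly\<close>

lemma ring_free_ring: "ring (free_ring :: 'f::field free_alg ring)"
proof -
  have "\<exists>y. x + y = 0" for x :: "'f free_alg"
    using add.right_inverse by blast
  then show ?thesis
    unfolding ring_of_type_algebra_def
    by unfold_locales (auto simp: algebra_simps Units_def)
qed

text \<open>Centrality of the scalars is what makes elements of the algebra act by linear maps.\<close>

lemma free_scalar_central: "free_scalar c * a = a * free_scalar (c :: 'f::field)"
proof (induction a rule: update_induct)
  case const
  then show ?case by simp
next
  case (update f a b)
  have "Poly_Mapping.update a b f = f + Poly_Mapping.single a b"
    using update.hyps by (intro poly_mapping_eqI)
      (auto simp: lookup_update lookup_add lookup_single in_keys_iff when_def)
  then show ?case
    using update.IH by (simp add: algebra_simps free_scalar_def mult_single)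
qed

lemma ideal_tet_ideal: "ideal (tet_ideal q) free_ring"
  unfolding tet_ideal_def
  by (intro ring.genideal_ideal[OF ring_free_ring]) (simp add: ring_of_type_algebra_def)

lemma tet_class_closed: "tet_class q a \<in> carrier (tet_alg q)"
  using ring_hom_closed[OF ideal.rcos_ring_hom[OF ideal_tet_ideal], of a q]
  by (simp add: tet_class_def tet_alg_def ring_of_type_algebra_def)

lemma tet_class_mult: "tet_class q (a * b) = tet_class q a \<otimes>\<^bsub>tet_alg q\<^esub> tet_class q b"
  using ring_hom_mult[OF ideal.rcos_ring_hom[OF ideal_tet_ideal], of a b q]
  by (simp add: tet_class_def tet_alg_def ring_of_type_algebra_def)

context tet_module
begin

lemma linear_act_class: "Vector_Spaces.linear scale scale (act (tet_class q a))"
proof -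
  have "act (tet_class q a) (scale c v) = scale c (act (tet_class q a) v)" for c v
  proof -
    have "act (tet_class q a) (scale c v) = act (tet_class q a) (act (tet_class q (free_scalar c)) v)"
      by (simp only: act_scalar)
    also have "\<dots> = act (tet_class q (free_scalar c * a)) v"
      by (simp only: act_mult[OF tet_class_closed tet_class_closed, symmetric] tet_class_mult[symmetric]
          free_scalar_central)
    also have "\<dots> = scale c (act (tet_class q a) v)"
      by (simp only: tet_class_mult act_mult[OF tet_class_closed tet_class_closed] act_scalar)
    finally show ?thesis .
  qed
  then show ?thesis
    using act_vec_add[OF tet_class_closed] vector_space_axioms
    by (simp add: Vector_Spaces.linear_iff)
qed

end


section \<open>Askey-Wilson relations from tridiagonal actions\<close>

text \<open>The relation at one vector, rather than as an identity of operators, since it is first checked on a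
  basis. The vector space structure is an explicit argument because that of a module is a parameter of
  its locale.\<close>

definition askey_wilson ::
  "('f::field \<Rightarrow> 'v::ab_group_add \<Rightarrow> 'v) \<Rightarrow> 'f \<Rightarrow> 'f \<Rightarrow> 'f \<Rightarrow> ('v \<Rightarrow> 'v) \<Rightarrow> ('v \<Rightarrow> 'v) \<Rightarrow> 'v \<Rightarrow> bool"
  where "askey_wilson scale \<beta> \<rho> \<sigma> A B v \<longleftrightarrow>
    A (A (B v)) - scale \<beta> (A (B (A v))) + B (A (A v)) = scale \<rho> (A v) + scale \<sigma> v"

context vector_space
begin

lemma askey_wilson_span:
  assumes A: "Vector_Spaces.linear (*s) (*s) A" and B: "Vector_Spaces.linear (*s) (*s) B"
    and gen: "\<And>v. v \<in> S \<Longrightarrow> askey_wilson (*s) \<beta> \<rho> \<sigma> A B v" and v: "v \<in> span S"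
  shows "askey_wilson (*s) \<beta> \<rho> \<sigma> A B v"
proof -
  interpret A: Vector_Spaces.linear "(*s)" "(*s)" A by (rule A)
  interpret B: Vector_Spaces.linear "(*s)" "(*s)" B by (rule B)
  show ?thesis
    using v
  proof (induction rule: span_induct_alt)
    case base
    then show ?case by (simp add: askey_wilson_def A.zero B.zero)
  next
    case (step c x y)
    have "c *s (A (A (B x)) - \<beta> *s A (B (A x)) + B (A (A x))) = c *s (\<rho> *s A x + \<sigma> *s x)"
      using gen[OF step(1)] by (simp add: askey_wilson_def)
    with step(2) show ?case
      by (simp add: askey_wilson_def A.add B.add A.scale B.scale algebra_simps)
  qed
qed

text \<open>Used as rewrite rules, these collect three linear combinations of the same vectors into one whose
  coefficients have the shape occurring in the Askey-Wilson relation.\<close>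

lemma three_term_combine:
  "(p *s u + x) - \<beta> *s (p' *s u + x') + (p'' *s u + x'')
    = (p - \<beta> * p' + p'') *s u + (x - \<beta> *s x' + x'')"
  "p *s u - \<beta> *s (p' *s u) + p'' *s u = (p - \<beta> * p' + p'') *s u"
  by (simp_all add: algebra_simps)

text \<open>The expression \<open>K\<^sup>2 A - \<beta> K A K + A K\<^sup>2\<close> arises from \<open>A\<close> by multiplying the coefficient from \<open>w m\<close> to \<open>w n\<close>
  by \<open>\<theta>\<^sub>n\<^sup>2 - \<beta> \<theta>\<^sub>n \<theta>\<^sub>m + \<theta>\<^sub>m\<^sup>2\<close>. By \<open>quad\<close> this symmetric form is zero at neighbours, so only the diagonal of
  \<open>A\<close> survives.\<close>

lemma askey_wilson_diagonal_tridiagonal: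
  fixes w :: "int \<Rightarrow> 'b"
  assumes K: "Vector_Spaces.linear (*s) (*s) K" and A: "Vector_Spaces.linear (*s) (*s) A"
    and Kw: "\<And>n. K (w n) = \<theta> n *s w n"
    and Aw: "\<And>n. A (w n) = a n *s w (n - 1) + b n *s w n + c n *s w (n + 1)"
    and quad: "\<And>n. \<theta> (n + 1) ^ 2 - \<beta> * (\<theta> (n + 1) * \<theta> n) + \<theta> n ^ 2 = 0"
    and diag: "\<And>n. (2 - \<beta>) * \<theta> n ^ 2 * b n = \<rho> * \<theta> n + \<sigma>"
  shows "askey_wilson (*s) \<beta> \<rho> \<sigma> K A (w n)"
proof -
  interpret K: Vector_Spaces.linear "(*s)" "(*s)" K by (rule K)
  interpret A: Vector_Spaces.linear "(*s)" "(*s)" A by (rule A)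
  have 1: "K (K (A (w n))) = (a n * \<theta> (n - 1) ^ 2) *s w (n - 1)
      + ((\<theta> n ^ 2 * b n) *s w n + (c n * \<theta> (n + 1) ^ 2) *s w (n + 1))"
    by (simp add: Kw Aw K.add K.scale algebra_simps power2_eq_square)
  have 2: "K (A (K (w n))) = (a n * \<theta> n * \<theta> (n - 1)) *s w (n - 1)
      + ((\<theta> n ^ 2 * b n) *s w n + (c n * \<theta> n * \<theta> (n + 1)) *s w (n + 1))"
    by (simp add: Kw Aw K.add A.add K.scale A.scale algebra_simps power2_eq_square)
  have 3: "A (K (K (w n))) = (a n * \<theta> n ^ 2) *s w (n - 1)
      + ((\<theta> n ^ 2 * b n) *s w n + (c n * \<theta> n ^ 2) *s w (n + 1))"
    by (simp add: Kw Aw K.scale A.scale algebra_simps power2_eq_square)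
  have "a n * \<theta> (n - 1) ^ 2 - \<beta> * (a n * \<theta> n * \<theta> (n - 1)) + a n * \<theta> n ^ 2 = 0"
    using arg_cong[OF quad[of "n - 1"], of "\<lambda>x. a n * x"] by (simp add: algebra_simps)
  moreover have "c n * \<theta> (n + 1) ^ 2 - \<beta> * (c n * \<theta> n * \<theta> (n + 1)) + c n * \<theta> n ^ 2 = 0"
    using arg_cong[OF quad[of n], of "\<lambda>x. c n * x"] by (simp add: algebra_simps)
  moreover have "\<theta> n ^ 2 * b n - \<beta> * (\<theta> n ^ 2 * b n) + \<theta> n ^ 2 * b n = \<rho> * \<theta> n + \<sigma>"
    using diag[of n] by (simp add: algebra_simps)
  ultimately show ?thesis
    unfolding askey_wilson_def 1 2 3 three_term_combine
    by (simp add: Kw scale_left_distrib)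
qed

text \<open>Comparison of coefficients: \<open>two\<close> is the condition two steps off the diagonal, \<open>one\<close> the condition one
  step off it, both after division by the entries of \<open>A\<close> that occur as common factors. By the symmetry of
  \<open>A\<^sup>2 K - \<beta> A K A + K A\<^sup>2\<close>, the steps up and down give the same conditions.\<close>

lemma askey_wilson_tridiagonal_diagonal:
  fixes w :: "int \<Rightarrow> 'b"
  assumes K: "Vector_Spaces.linear (*s) (*s) K" and A: "Vector_Spaces.linear (*s) (*s) A"
    and Kw: "\<And>n. K (w n) = \<theta> n *s w n"
    and Aw: "\<And>n. A (w n) = a n *s w (n - 1) + b n *s w n + c n *s w (n + 1)"
    and two: "\<And>n. \<theta> (n + 1) + \<theta> (n - 1) = \<beta> * \<theta> n"
    and one: "\<And>n. (b n + b (n + 1)) * (\<theta> n + \<theta> (n + 1)) - \<beta> * (b n * \<theta> n + b (n + 1) * \<theta> (n + 1)) = \<rho>"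
    and diag: "\<And>n. 2 * \<theta> n * (b n ^ 2 + a n * c (n - 1) + c n * a (n + 1))
      - \<beta> * (b n ^ 2 * \<theta> n + a n * c (n - 1) * \<theta> (n - 1) + c n * a (n + 1) * \<theta> (n + 1))
      = \<rho> * b n + \<sigma>"
  shows "askey_wilson (*s) \<beta> \<rho> \<sigma> A K (w n)"
proof -
  interpret K: Vector_Spaces.linear "(*s)" "(*s)" K by (rule K)
  interpret A: Vector_Spaces.linear "(*s)" "(*s)" A by (rule A)
  have 1: "A (A (K (w n))) =
     (a n * a (n - 1) * \<theta> n) *s w (n - 2)
     + (a n * (b (n - 1) + b n) * \<theta> n) *s w (n - 1)
     + (\<theta> n * (b n ^ 2 + a n * c (n - 1) + c n * a (n + 1))) *s w n
     + (c n * (b n + b (n + 1)) * \<theta> n) *s w (n + 1)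
     + (c n * c (n + 1) * \<theta> n) *s w (n + 2)"
    by (simp add: Kw Aw K.add A.add K.scale A.scale algebra_simps power2_eq_square)
  have 2: "A (K (A (w n))) =
     (a n * a (n - 1) * \<theta> (n - 1)) *s w (n - 2)
     + (a n * (b (n - 1) * \<theta> (n - 1) + b n * \<theta> n)) *s w (n - 1)
     + ((b n ^ 2 * \<theta> n + a n * c (n - 1) * \<theta> (n - 1) + c n * a (n + 1) * \<theta> (n + 1))) *s w n
     + (c n * (b n * \<theta> n + b (n + 1) * \<theta> (n + 1))) *s w (n + 1)
     + (c n * c (n + 1) * \<theta> (n + 1)) *s w (n + 2)"
    by (simp add: Kw Aw K.add A.add K.scale A.scale algebra_simps power2_eq_square)
  have 3: "K (A (A (w n))) =
     (a n * a (n - 1) * \<theta> (n - 2)) *s w (n - 2)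
     + (a n * (b (n - 1) + b n) * \<theta> (n - 1)) *s w (n - 1)
     + (\<theta> n * (b n ^ 2 + a n * c (n - 1) + c n * a (n + 1))) *s w n
     + (c n * (b n + b (n + 1)) * \<theta> (n + 1)) *s w (n + 1)
     + (c n * c (n + 1) * \<theta> (n + 2)) *s w (n + 2)"
    by (simp add: Kw Aw K.add A.add K.scale A.scale algebra_simps power2_eq_square)
  have "A (A (K (w n))) - \<beta> *s A (K (A (w n))) + K (A (A (w n)))
      = (\<rho> * a n) *s w (n - 1) + (\<rho> * b n + \<sigma>) *s w n + (\<rho> * c n) *s w (n + 1)"
  proof -
    have "a n * a (n - 1) * \<theta> n - \<beta> * (a n * a (n - 1) * \<theta> (n - 1)) + a n * a (n - 1) * \<theta> (n - 2) = 0"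
      using arg_cong[OF two[of "n - 1"], of "\<lambda>x. a n * a (n - 1) * x"] by (simp add: algebra_simps)
    moreover have "c n * c (n + 1) * \<theta> n - \<beta> * (c n * c (n + 1) * \<theta> (n + 1)) + c n * c (n + 1) * \<theta> (n + 2) = 0"
      using arg_cong[OF two[of "n + 1"], of "\<lambda>x. c n * c (n + 1) * x"] by (simp add: algebra_simps)
    moreover have "a n * (b (n - 1) + b n) * \<theta> n - \<beta> * (a n * (b (n - 1) * \<theta> (n - 1) + b n * \<theta> n))
       + a n * (b (n - 1) + b n) * \<theta> (n - 1) = \<rho> * a n"
      using arg_cong[OF one[of "n - 1"], of "\<lambda>x. a n * x"] by (simp add: algebra_simps)
    moreover have "c n * (b n + b (n + 1)) * \<theta> n - \<beta> * (c n * (b n * \<theta> n + b (n + 1) * \<theta> (n + 1)))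
       + c n * (b n + b (n + 1)) * \<theta> (n + 1) = \<rho> * c n"
      using arg_cong[OF one[of n], of "\<lambda>x. c n * x"] by (simp add: algebra_simps)
    moreover have "\<theta> n * (b n ^ 2 + a n * c (n - 1) + c n * a (n + 1))
      - \<beta> * (b n ^ 2 * \<theta> n + a n * c (n - 1) * \<theta> (n - 1) + c n * a (n + 1) * \<theta> (n + 1))
      + \<theta> n * (b n ^ 2 + a n * c (n - 1) + c n * a (n + 1)) = \<rho> * b n + \<sigma>"
      using diag[of n] by Groebner_Basis.algebra
    ultimately show ?thesis
      unfolding 1 2 3 add.assoc three_term_combine by (simp add: add.assoc)
  qed
  then show ?thesis
    by (simp add: askey_wilson_def Aw scale_left_distrib scale_right_distrib add_ac)
qed

text \<open>Comparison of coefficients: \<open>two\<close> is the condition at \<open>w (n - 2)\<close>, \<open>one\<close> that at \<open>w (n - 1)\<close>, \<open>diag\<close> that at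
  \<open>w n\<close> and \<open>quad\<close> that at \<open>w (n + 1)\<close>, each after division by common factors.\<close>

lemma askey_wilson_bidiagonal:
  fixes w :: "int \<Rightarrow> 'b"
  assumes E: "Vector_Spaces.linear (*s) (*s) E" and F: "Vector_Spaces.linear (*s) (*s) F"
    and Ew: "\<And>n. E (w n) = e n *s w (n - 1) + \<theta> n *s w n"
    and Fw: "\<And>n. F (w n) = \<theta> n *s w n + f n *s w (n + 1)"
    and two: "\<And>n. \<theta> (n + 1) + \<theta> (n - 1) = \<beta> * \<theta> n"
    and quad: "\<And>n. \<theta> (n + 1) ^ 2 - \<beta> * (\<theta> (n + 1) * \<theta> n) + \<theta> n ^ 2 = 0"
    and one: "\<And>n. \<theta> n * (\<theta> n + \<theta> (n - 1)) + \<theta> (n - 1) * (\<theta> n + \<theta> (n - 1))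
      - \<beta> * (\<theta> n ^ 2 + \<theta> (n - 1) ^ 2)
      + f n * e (n + 1) - \<beta> * (e n * f (n - 1)) + e (n - 1) * f (n - 2) = \<rho>"
    and diag: "\<And>n. (2 - \<beta>) * \<theta> n ^ 3
      + f n * e (n + 1) * (\<theta> (n + 1) + \<theta> n - \<beta> * \<theta> n)
      + e n * f (n - 1) * (\<theta> n + \<theta> (n - 1) - \<beta> * \<theta> n) = \<rho> * \<theta> n + \<sigma>"
  shows "askey_wilson (*s) \<beta> \<rho> \<sigma> E F (w n)"
proof -
  interpret E: Vector_Spaces.linear "(*s)" "(*s)" E by (rule E)
  interpret F: Vector_Spaces.linear "(*s)" "(*s)" F by (rule F)
  have 1: "E (E (F (w n))) = (\<theta> n * e n * e (n - 1)) *s w (n - 2)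
     + ((e n * (\<theta> n * (\<theta> n + \<theta> (n - 1)) + f n * e (n + 1))) *s w (n - 1)
     + ((\<theta> n ^ 3 + f n * e (n + 1) * (\<theta> (n + 1) + \<theta> n)) *s w n
     + (f n * \<theta> (n + 1) ^ 2) *s w (n + 1)))"
    by (simp add: Ew Fw E.add E.scale algebra_simps power2_eq_square power3_eq_cube)
  have 2: "E (F (E (w n))) = (e n * e (n - 1) * \<theta> (n - 1)) *s w (n - 2)
     + ((e n * (\<theta> n ^ 2 + \<theta> (n - 1) ^ 2 + e n * f (n - 1))) *s w (n - 1)
     + ((\<theta> n ^ 3 + f n * e (n + 1) * \<theta> n + e n * f (n - 1) * \<theta> n) *s w n
     + (f n * (\<theta> (n + 1) * \<theta> n)) *s w (n + 1)))"
    by (simp add: Ew Fw E.add F.add E.scale F.scale algebra_simps power2_eq_square power3_eq_cube)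
  have 3: "F (E (E (w n))) = (e n * e (n - 1) * \<theta> (n - 2)) *s w (n - 2)
     + ((e n * (\<theta> (n - 1) * (\<theta> n + \<theta> (n - 1)) + e (n - 1) * f (n - 2))) *s w (n - 1)
     + ((\<theta> n ^ 3 + e n * f (n - 1) * (\<theta> n + \<theta> (n - 1))) *s w n
     + (f n * \<theta> n ^ 2) *s w (n + 1)))"
    by (simp add: Ew Fw E.add F.add E.scale F.scale algebra_simps power2_eq_square power3_eq_cube)
  have "\<theta> n * e n * e (n - 1) - \<beta> * (e n * e (n - 1) * \<theta> (n - 1)) + e n * e (n - 1) * \<theta> (n - 2) = 0"
    using arg_cong[OF two[of "n - 1"], of "\<lambda>x. e n * e (n - 1) * x"] by (simp add: algebra_simps)
  moreover have "e n * (\<theta> n * (\<theta> n + \<theta> (n - 1)) + f n * e (n + 1))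
      - \<beta> * (e n * (\<theta> n ^ 2 + \<theta> (n - 1) ^ 2 + e n * f (n - 1)))
      + e n * (\<theta> (n - 1) * (\<theta> n + \<theta> (n - 1)) + e (n - 1) * f (n - 2)) = \<rho> * e n"
    using arg_cong[OF one[of n], of "\<lambda>x. e n * x"] by (simp add: algebra_simps)
  moreover have "\<theta> n ^ 3 + f n * e (n + 1) * (\<theta> (n + 1) + \<theta> n)
      - \<beta> * (\<theta> n ^ 3 + f n * e (n + 1) * \<theta> n + e n * f (n - 1) * \<theta> n)
      + (\<theta> n ^ 3 + e n * f (n - 1) * (\<theta> n + \<theta> (n - 1))) = \<rho> * \<theta> n + \<sigma>"
    using diag[of n] by (simp add: algebra_simps)
  moreover have "f n * \<theta> (n + 1) ^ 2 - \<beta> * (f n * (\<theta> (n + 1) * \<theta> n)) + f n * \<theta> n ^ 2 = 0"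
    using arg_cong[OF quad[of n], of "\<lambda>x. f n * x"] by (simp add: algebra_simps)
  ultimately show ?thesis
    unfolding askey_wilson_def 1 2 3 three_term_combine
    by (simp add: Ew scale_left_distrib scale_right_distrib add_ac)
qed

text \<open>Rescaling the vectors \<open>w n\<close> changes \<open>e\<close> and \<open>f\<close> but not the products \<open>f n * e (n + 1)\<close>, so it is natural that
  the relation constrains these products only. Stating \<open>prod\<close> for them makes the lemma indifferent to which
  of the two operators carries the factor with the parameter \<open>T\<close>; it is applied once with this factor in the
  raising and once in the lowering operator. In the applications \<open>D\<close> is \<open>q\<^sup>d\<close> and its inverse.\<close>

lemma askey_wilson_geometric_bidiagonal:
  fixes w :: "int \<Rightarrow> 'b"
  assumes E: "Vector_Spaces.linear (*s) (*s) E" and F: "Vector_Spaces.linear (*s) (*s) F"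
    and Ew: "\<And>n. E (w n) = e n *s w (n - 1) + \<theta> n *s w n"
    and Fw: "\<And>n. F (w n) = \<theta> n *s w n + f n *s w (n + 1)"
    and q: "q \<noteq> 0" and D: "D \<noteq> 0" and nz: "\<And>n. \<theta> n \<noteq> 0"
    and step: "\<And>n. \<theta> (n + 1) = q\<^sup>2 * \<theta> n"
    and prod: "\<And>n. f n * e (n + 1) =
      (inverse D - q\<^sup>2 * \<theta> n) * (D - \<theta> n) * (1 - T * inverse q * inverse (\<theta> n))"
  shows "askey_wilson (*s) (q\<^sup>2 + inverse q ^ 2)
    (- ((q - inverse q)\<^sup>2 * (1 + T * (q * D + inverse (q * D)))))
    ((q - inverse q) * (q\<^sup>2 - inverse q ^ 2) * T) E F (w n)"
proof (rule askey_wilson_bidiagonal[where w = w and e = e and f = f and \<theta> = \<theta>, OF E F Ew Fw])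
  define p where "p = inverse q"
  define Di where "Di = inverse D"
  have pq: "q * p = 1" "D * Di = 1" "inverse (q * D) = p * Di"
    using q D by (auto simp: p_def Di_def)
  have prev: "\<theta> (n - 1) = p\<^sup>2 * \<theta> n" for n
    using step[of "n - 1"] q by (simp add: p_def Di_def field_simps)
  have prev2: "\<theta> (n - 2) = p\<^sup>2 * (p\<^sup>2 * \<theta> n)" for n
    using prev[of "n - 1"] prev[of n] by simp
  have down: "inverse (\<theta> (n - 1)) = q\<^sup>2 * inverse (\<theta> n)" for n
    by (simp add: prev p_def power_inverse)
  have down2: "inverse (\<theta> (n - 2)) = q\<^sup>2 * (q\<^sup>2 * inverse (\<theta> n))" for n
    using down[of "n - 1"] down[of n] by simp
  show "\<theta> (n + 1) + \<theta> (n - 1) = (q\<^sup>2 + inverse q ^ 2) * \<theta> n" for n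
    unfolding step prev p_def Di_def by Groebner_Basis.algebra
  show "\<theta> (n + 1) ^ 2 - (q\<^sup>2 + inverse q ^ 2) * (\<theta> (n + 1) * \<theta> n) + \<theta> n ^ 2 = 0" for n
    unfolding step p_def[symmetric] using pq by Groebner_Basis.algebra
  (* With the inverses as separate variables, subject to q p = D Di = x xi = 1, the two remaining
     conditions are polynomial identities. *)
  fix n
  define x where "x = \<theta> n"
  define xi where "xi = inverse (\<theta> n)"
  have x: "x * xi = 1"
    using nz by (simp add: x_def xi_def)
  have g0: "f n * e (n + 1) = (Di - q\<^sup>2 * x) * (D - x) * (1 - T * p * xi)"
    by (simp add: prod x_def xi_def p_def Di_def)
  have g1: "e n * f (n - 1) = (Di - x) * (D - p\<^sup>2 * x) * (1 - T * q * xi)"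
    using prod[of "n - 1", unfolded diff_add_cancel down, unfolded prev, folded p_def Di_def x_def xi_def] pq(1)
    by Groebner_Basis.algebra
  have g2: "e (n - 1) * f (n - 2) = (Di - p\<^sup>2 * x) * (D - p\<^sup>2 * (p\<^sup>2 * x)) * (1 - T * q ^ 3 * xi)"
    using prod[of "n - 2", unfolded down2, unfolded prev2, folded p_def Di_def x_def xi_def] pq(1)
    by simp Groebner_Basis.algebra
  show "\<theta> n * (\<theta> n + \<theta> (n - 1)) + \<theta> (n - 1) * (\<theta> n + \<theta> (n - 1))
      - (q\<^sup>2 + inverse q ^ 2) * (\<theta> n ^ 2 + \<theta> (n - 1) ^ 2)
      + f n * e (n + 1) - (q\<^sup>2 + inverse q ^ 2) * (e n * f (n - 1)) + e (n - 1) * f (n - 2)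
      = - ((q - inverse q)\<^sup>2 * (1 + T * (q * D + inverse (q * D))))"
    unfolding g0 g1 g2 prev pq p_def[symmetric] x_def[symmetric]
    using pq x by Groebner_Basis.algebra
  show "(2 - (q\<^sup>2 + inverse q ^ 2)) * \<theta> n ^ 3
      + f n * e (n + 1) * (\<theta> (n + 1) + \<theta> n - (q\<^sup>2 + inverse q ^ 2) * \<theta> n)
      + e n * f (n - 1) * (\<theta> n + \<theta> (n - 1) - (q\<^sup>2 + inverse q ^ 2) * \<theta> n)
      = - ((q - inverse q)\<^sup>2 * (1 + T * (q * D + inverse (q * D)))) * \<theta> n
        + (q - inverse q) * (q\<^sup>2 - inverse q ^ 2) * T"
    unfolding g0 g1 prev step pq p_def[symmetric] x_def[symmetric]
    using pq x by Groebner_Basis.algebra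
qed

text \<open>The eigenvalues of \<open>K\<close> are the inverses of \<open>\<theta> n\<close>. The relation beginning with \<open>K\<^sup>2 A\<close> holds because
  \<open>b n\<close> is this quadratic polynomial in \<open>\<theta> n\<close>; the relation beginning with \<open>A\<^sup>2 K\<close> involves the
  off-diagonal entries of \<open>A\<close> through the products \<open>c n * a (n + 1)\<close> alone.\<close>

lemma askey_wilson_geometric_tridiagonal:
  fixes w :: "int \<Rightarrow> 'b"
  assumes K: "Vector_Spaces.linear (*s) (*s) K" and A: "Vector_Spaces.linear (*s) (*s) A"
    and Kw: "\<And>n. K (w n) = inverse (\<theta> n) *s w n"
    and Aw: "\<And>n. A (w n) = a n *s w (n - 1) + b n *s w n + c n *s w (n + 1)"
    and q: "q \<noteq> 0" and D: "D \<noteq> 0" and nz: "\<And>n. \<theta> n \<noteq> 0"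
    and step: "\<And>n. \<theta> (n + 1) = q\<^sup>2 * \<theta> n"
    and b: "\<And>n. b n = (1 + T * (q * D + inverse (q * D))) * \<theta> n - T * (q + inverse q) * \<theta> n ^ 2"
    and prod: "\<And>n. c n * a (n + 1) =
      (inverse D - q\<^sup>2 * \<theta> n) * (\<theta> n - D) * (1 - T * q * \<theta> n) * T * q * \<theta> n"
  shows "askey_wilson (*s) (q\<^sup>2 + inverse q ^ 2)
      (- ((q - inverse q)\<^sup>2 * (1 + T * (q * D + inverse (q * D)))))
      ((q - inverse q) * (q\<^sup>2 - inverse q ^ 2) * T) K A (w n)" (is ?KA)
    and "askey_wilson (*s) (q\<^sup>2 + inverse q ^ 2)
      (- ((q - inverse q)\<^sup>2 * (1 + T * (q * D + inverse (q * D)))))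
      ((q - inverse q) * (q\<^sup>2 - inverse q ^ 2) * T) A K (w n)" (is ?AK)
proof -
  define p where "p = inverse q"
  define Di where "Di = inverse D"
  have pq: "q * p = 1" "D * Di = 1" "inverse (q * D) = p * Di"
    using q D by (auto simp: p_def Di_def)
  have prev: "\<theta> (n - 1) = p\<^sup>2 * \<theta> n" for n
    using step[of "n - 1"] q by (simp add: p_def Di_def field_simps)
  have up: "inverse (\<theta> (n + 1)) = p\<^sup>2 * inverse (\<theta> n)" for n
    by (simp add: step p_def Di_def power_inverse)
  have down: "inverse (\<theta> (n - 1)) = q\<^sup>2 * inverse (\<theta> n)" for n
    by (simp add: prev p_def Di_def power_inverse)
  have inv: "\<theta> n * inverse (\<theta> n) = 1" for n
    using nz by simp
  have quad: "inverse (\<theta> (n + 1)) ^ 2 - (q\<^sup>2 + inverse q ^ 2) * (inverse (\<theta> (n + 1)) * inverse (\<theta> n))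
      + inverse (\<theta> n) ^ 2 = 0" for n
    unfolding up p_def[symmetric] using pq by Groebner_Basis.algebra
  have two: "inverse (\<theta> (n + 1)) + inverse (\<theta> (n - 1)) = (q\<^sup>2 + inverse q ^ 2) * inverse (\<theta> n)" for n
    unfolding up down p_def Di_def by Groebner_Basis.algebra
  have diagKA: "(2 - (q\<^sup>2 + inverse q ^ 2)) * inverse (\<theta> n) ^ 2 * b n
      = - ((q - inverse q)\<^sup>2 * (1 + T * (q * D + inverse (q * D)))) * inverse (\<theta> n)
        + (q - inverse q) * (q\<^sup>2 - inverse q ^ 2) * T" for n
    unfolding b pq p_def[symmetric] using pq inv[of n] by Groebner_Basis.algebra
  have one: "(b n + b (n + 1)) * (inverse (\<theta> n) + inverse (\<theta> (n + 1)))
      - (q\<^sup>2 + inverse q ^ 2) * (b n * inverse (\<theta> n) + b (n + 1) * inverse (\<theta> (n + 1)))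
      = - ((q - inverse q)\<^sup>2 * (1 + T * (q * D + inverse (q * D))))" for n
    unfolding up unfolding b step pq p_def[symmetric] using pq inv[of n] by Groebner_Basis.algebra
  have prod': "a n * c (n - 1) =
      (Di - \<theta> n) * (p\<^sup>2 * \<theta> n - D) * (1 - T * p * \<theta> n) * T * p * \<theta> n" for n
    using prod[of "n - 1", unfolded diff_add_cancel prev, folded p_def Di_def] pq(1) by Groebner_Basis.algebra
  have diagAK: "2 * inverse (\<theta> n) * (b n ^ 2 + a n * c (n - 1) + c n * a (n + 1))
      - (q\<^sup>2 + inverse q ^ 2) * (b n ^ 2 * inverse (\<theta> n) + a n * c (n - 1) * inverse (\<theta> (n - 1))
        + c n * a (n + 1) * inverse (\<theta> (n + 1)))
      = - ((q - inverse q)\<^sup>2 * (1 + T * (q * D + inverse (q * D)))) * b n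
        + (q - inverse q) * (q\<^sup>2 - inverse q ^ 2) * T" for n
    unfolding b prod prod' up down pq p_def[symmetric] Di_def[symmetric]
    using pq inv[of n] by Groebner_Basis.algebra
  show ?KA
    by (rule askey_wilson_diagonal_tridiagonal[where w = w and a = a and b = b and c = c
          and \<theta> = "\<lambda>n. inverse (\<theta> n)", OF K A Kw Aw quad diagKA])
  show ?AK
    by (rule askey_wilson_tridiagonal_diagonal[where w = w and a = a and b = b and c = c
          and \<theta> = "\<lambda>n. inverse (\<theta> n)", OF K A Kw Aw two one diagAK])
qed

end

section \<open>The weights of the basis\<close>

lemma powi_shift:
  assumes "(q::'a::field) \<noteq> 0"
  shows "q powi (k + 1) = q * q powi k" "q powi (k - 1) = inverse q * q powi k"
    "q powi (k + 2) = q ^ 2 * q powi k" "q powi (k - 2) = inverse q ^ 2 * q powi k"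
  using assms by (simp_all add: power_int_add power_int_diff divide_simps)

lemma inverse_powi_minus: "inverse (q::'a::field) powi (- k) = q powi k"
  by (simp add: power_int_inverse power_int_minus)

text \<open>The diagonal entry of \<open>x\<^sub>1\<^sub>2\<close> in position \<open>n\<close>, which is also that of \<open>x\<^sub>3\<^sub>0\<close> and the inverse of that of \<open>x\<^sub>2\<^sub>3\<close>. The
  index is an integer so that the positions just outside the basis are included.\<close>

definition weight :: "'f::field \<Rightarrow> nat \<Rightarrow> int \<Rightarrow> 'f"
  where "weight q d n = q powi (2 * n - int d)"

lemma weight_nonzero: "q \<noteq> 0 \<Longrightarrow> weight q d n \<noteq> 0"
  by (simp add: weight_def)

lemma weight_step: "q \<noteq> 0 \<Longrightarrow> weight q d (n + 1) = q\<^sup>2 * weight q d n"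
  using powi_shift(3)[of q "2 * n - int d"] by (simp add: weight_def algebra_simps)

text \<open>These values make the coefficients that lead into the basis from outside vanish.\<close>

lemma weight_beyond_end:
  assumes "q \<noteq> 0"
  shows "weight q d (int d + 1) = q\<^sup>2 * q ^ d" "weight q d (- 1) = inverse q ^ 2 * inverse (q ^ d)"
proof -
  show "weight q d (int d + 1) = q\<^sup>2 * q ^ d"
    using weight_step[OF assms, of d "int d"] by (simp add: weight_def)
  have "q powi (- int d - 2) = inverse q ^ 2 * q powi (- int d)"
    by (rule powi_shift(4)[OF assms])
  moreover have "2 * - 1 - int d = - int d - 2"
    by simp
  ultimately show "weight q d (- 1) = inverse q ^ 2 * inverse (q ^ d)"
    by (simp only: weight_def power_int_minus power_int_of_nat)
qed

lemma powi_weight: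
  assumes "q \<noteq> 0"
  shows "q powi (2 * n - 2 - int d) = inverse q ^ 2 * weight q d n"
  using powi_shift(4)[OF assms, of "2 * n - int d"] by (simp add: weight_def algebra_simps)

text \<open>The powers of \<open>q\<^sup>-\<^sup>1\<close> that occur in \<open>S\<close> and \<open>G\<close> with parameter \<open>q\<^sup>-\<^sup>1\<close>, at the index \<open>d - n\<close> into which
  conjugation by \<open>Z\<close> turns \<open>n\<close>.\<close>

lemma weight_reflect:
  assumes "q \<noteq> 0"
  shows "inverse q powi (2 * (int d - n) - int d) = weight q d n"
   "inverse q powi (2 * (int d - n) - int d - 1) = q * weight q d n"
   "inverse q powi (2 * (int d - n) - int d + 1) = inverse q * weight q d n"
   "inverse q powi (2 * (int d - n) - int d - 2) = q\<^sup>2 * weight q d n"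
   "inverse q powi (2 * (int d - n) - 2 - int d) = q\<^sup>2 * weight q d n"
   "inverse q powi (int d - 2 * (int d - n) + 1) = inverse q * inverse (weight q d n)"
proof -
  have *: "2 * (int d - n) - int d = - (2 * n - int d)" "2 * (int d - n) - int d - 1 = - (2 * n - int d + 1)"
   "2 * (int d - n) - int d + 1 = - (2 * n - int d - 1)"
   "2 * (int d - n) - 2 - int d = - (2 * n - int d + 2)"
   "int d - 2 * (int d - n) + 1 = 2 * n - int d + 1"
   "2 * (int d - n) - int d - 2 = - (2 * n - int d + 2)"
    by simp_all
  show "inverse q powi (2 * (int d - n) - int d) = weight q d n"
    by (simp only: *(1) weight_def inverse_powi_minus)
  show "inverse q powi (2 * (int d - n) - int d - 1) = q * weight q d n"
    by (simp only: *(2) weight_def inverse_powi_minus powi_shift[OF assms])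
  show "inverse q powi (2 * (int d - n) - int d + 1) = inverse q * weight q d n"
    by (simp only: *(3) weight_def inverse_powi_minus powi_shift[OF assms])
  show "inverse q powi (2 * (int d - n) - int d - 2) = q\<^sup>2 * weight q d n"
    by (simp only: *(6) weight_def inverse_powi_minus powi_shift[OF assms])
  show "inverse q powi (2 * (int d - n) - 2 - int d) = q\<^sup>2 * weight q d n"
    by (simp only: *(4) weight_def inverse_powi_minus powi_shift[OF assms])
  show "inverse q powi (int d - 2 * (int d - n) + 1) = inverse q * inverse (weight q d n)"
    by (simp only: *(5) weight_def power_int_inverse powi_shift[OF assms] inverse_mult_distrib)
qed


section \<open>The generators on the basis\<close>

lemma flip_mat_index:
  fixes M :: "'f::field mat"
  assumes "M \<in> carrier_mat (d + 1) (d + 1)" "i \<le> d" "j \<le> d"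
  shows "(Z_mat d * M * Z_mat d) $$ (i, j) = M $$ (d - i, d - j)"
proof -
  have Z: "dim_row (Z_mat d :: 'f mat) = d + 1" "dim_col (Z_mat d :: 'f mat) = d + 1" by (simp_all add: Z_mat_def)
  have ZM: "(Z_mat d * M) $$ (i, k) = M $$ (d - i, k)" if "k \<le> d" for k
  proof -
    have "(Z_mat d * M) $$ (i, k) = (\<Sum>l\<in>{0..<d + 1}. Z_mat d $$ (i, l) * M $$ (l, k))"
      using assms Z that by (simp add: scalar_prod_def del: sum.op_ivl_Suc)
    also have "\<dots> = (\<Sum>l\<in>{0..<d + 1}. if l = d - i then M $$ (l, k) else 0)"
      using assms that by (intro sum.cong) (auto simp: Z_mat_def)
    finally show ?thesis by simp
  qed
  have "(Z_mat d * M * Z_mat d) $$ (i, j) = (\<Sum>l\<in>{0..<d + 1}. (Z_mat d * M) $$ (i, l) * Z_mat d $$ (l, j))"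
    using assms Z by (simp add: scalar_prod_def del: sum.op_ivl_Suc)
  also have "\<dots> = (\<Sum>l\<in>{0..<d + 1}. if l = d - j then M $$ (d - i, l) else 0)"
    using assms ZM by (intro sum.cong) (auto simp: Z_mat_def)
  finally show ?thesis by simp
qed

definition extend_by_zero :: "nat \<Rightarrow> (nat \<Rightarrow> 'v::zero) \<Rightarrow> int \<Rightarrow> 'v"
  where "extend_by_zero d v n = (if 0 \<le> n \<and> n \<le> int d then v (nat n) else 0)"

context tet_module
begin

text \<open>The hypotheses \<open>boundary\<close> serve the two integers next to the basis: there the left side is zero,
  while the right side contains \<open>v\<^sub>d\<close> or \<open>v\<^sub>0\<close>.\<close>

lemma tridiagonal_action:
  assumes f: "Vector_Spaces.linear scale scale f" and M: "represents d v M f"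
    and entries: "\<And>i n. i \<le> d \<Longrightarrow> n \<le> d \<Longrightarrow> M $$ (i, n) =
      (if i = n then b (int n) else if n = i + 1 then a (int n) else if i = n + 1 then c (int n) else 0)"
    and boundary: "a (int d + 1) = 0" "c (- 1) = 0"
  shows "f (extend_by_zero d v n) = scale (a n) (extend_by_zero d v (n - 1))
    + scale (b n) (extend_by_zero d v n) + scale (c n) (extend_by_zero d v (n + 1))"
proof (cases "0 \<le> n \<and> n \<le> int d")
  case True
  then obtain m where m: "n = int m" "m \<le> d"
    by (metis int_nat_eq nat_le_iff)
  have "f (v m) = (\<Sum>i\<le>d. scale (M $$ (i, m)) (v i))"
    using M m by (simp add: represents_def)
  also have "\<dots> = (\<Sum>i\<le>d. (if i = m then scale (b n) (v i) else 0)
     + ((if i + 1 = m then scale (a n) (v i) else 0) + (if i = m + 1 then scale (c n) (v i) else 0)))"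
    using m by (intro sum.cong) (auto simp: entries)
  also have "\<dots> = scale (b n) (v m)
      + ((\<Sum>i\<le>d. if i + 1 = m then scale (a n) (v i) else 0) + (\<Sum>i\<le>d. if i = m + 1 then scale (c n) (v i) else 0))"
    using m by (simp add: sum.distrib)
  also have "(\<Sum>i\<le>d. if i + 1 = m then scale (a n) (v i) else 0) = scale (a n) (extend_by_zero d v (n - 1))"
    using m by (cases m) (simp_all add: extend_by_zero_def)
  also have "(\<Sum>i\<le>d. if i = m + 1 then scale (c n) (v i) else 0) = scale (c n) (extend_by_zero d v (n + 1))"
    using m by (simp add: extend_by_zero_def nat_add_distrib)
  finally show ?thesis
    using m by (simp add: extend_by_zero_def add_ac)
next
  case False
  interpret f: Vector_Spaces.linear scale scale f by (rule f)
  have "a n = 0 \<or> extend_by_zero d v (n - 1) = 0"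
    using False boundary(1) by (cases "n = int d + 1") (auto simp: extend_by_zero_def)
  moreover have "c n = 0 \<or> extend_by_zero d v (n + 1) = 0"
    using False boundary(2) by (cases "n = - 1") (auto simp: extend_by_zero_def)
  moreover have "extend_by_zero d v n = 0"
    using False by (auto simp: extend_by_zero_def)
  ultimately show ?thesis
    by (auto simp: f.zero)
qed

lemma linear_gen_act: "Vector_Spaces.linear scale scale (gen_act i j)"
  unfolding gen_act_def std_def by (rule linear_act_class)

lemma x23_diagonal:
  assumes "represents d v (K_mat d q) (gen_act 2 3)"
  shows "gen_act 2 3 (extend_by_zero d v n) = scale (inverse (weight q d n)) (extend_by_zero d v n)"
proof -
  have "gen_act 2 3 (extend_by_zero d v n) = scale 0 (extend_by_zero d v (n - 1))
      + scale (inverse (weight q d n)) (extend_by_zero d v n) + scale 0 (extend_by_zero d v (n + 1))"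
    using linear_gen_act assms
  proof (rule tridiagonal_action)
    fix i n assume "i \<le> d" "n \<le> d"
    then show "K_mat d q $$ (i, n) = (if i = n then inverse (weight q d (int n))
        else if n = i + 1 then 0 else if i = n + 1 then 0 else 0)"
      by (simp add: K_mat_def weight_def flip: power_int_minus)
  qed simp_all
  then show ?thesis by simp
qed

lemma x12_bidiagonal:
  assumes "q \<noteq> 0" and "represents d v (E_mat d q) (gen_act 1 2)"
  shows "gen_act 1 2 (extend_by_zero d v n) =
    scale (q ^ d - inverse q ^ 2 * weight q d n) (extend_by_zero d v (n - 1))
    + scale (weight q d n) (extend_by_zero d v n)"
proof -
  have "gen_act 1 2 (extend_by_zero d v n) =
      scale (q ^ d - inverse q ^ 2 * weight q d n) (extend_by_zero d v (n - 1))
      + scale (weight q d n) (extend_by_zero d v n) + scale 0 (extend_by_zero d v (n + 1))"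
    using linear_gen_act assms(2)
  proof (rule tridiagonal_action)
    fix i n assume "i \<le> d" "n \<le> d"
    then show "E_mat d q $$ (i, n) = (if i = n then weight q d (int n)
        else if n = i + 1 then q ^ d - inverse q ^ 2 * weight q d (int n)
        else if i = n + 1 then 0 else 0)"
      unfolding powi_weight[OF assms(1), symmetric] by (simp add: E_mat_def weight_def)
  next
    show "q ^ d - inverse q ^ 2 * weight q d (int d + 1) = 0"
      unfolding weight_beyond_end[OF assms(1)] using assms(1) by (simp add: field_simps)
  qed simp
  then show ?thesis by simp
qed

lemma x30_bidiagonal:
  assumes "q \<noteq> 0" and "represents d v (Z_mat d * G_mat d (inverse q) t * Z_mat d) (gen_act 3 0)"
  shows "gen_act 3 0 (extend_by_zero d v n) =
    scale (weight q d n) (extend_by_zero d v n)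
    + scale ((inverse (q ^ d) - q\<^sup>2 * weight q d n) * (1 - t * (inverse q * inverse (weight q d n))))
      (extend_by_zero d v (n + 1))"
proof -
  have "gen_act 3 0 (extend_by_zero d v n) =
      scale 0 (extend_by_zero d v (n - 1)) + scale (weight q d n) (extend_by_zero d v n)
      + scale ((inverse (q ^ d) - q\<^sup>2 * weight q d n) * (1 - t * (inverse q * inverse (weight q d n))))
        (extend_by_zero d v (n + 1))"
    using linear_gen_act assms(2)
  proof (rule tridiagonal_action)
    fix i n assume le: "i \<le> d" "n \<le> d"
    have carrier: "G_mat d (inverse q) t \<in> carrier_mat (d + 1) (d + 1)"
      by (simp add: G_mat_def)
    have pos: "d - i = d - n \<longleftrightarrow> i = n" "d - n = d - i + 1 \<longleftrightarrow> i = n + 1"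
      using le by auto
    have lt: "d - i < d + 1" "d - n < d + 1"
      by simp_all
    have "G_mat d (inverse q) t $$ (d - i, d - n) = (if i = n then weight q d (int i)
        else if i = n + 1 then (inverse (q ^ d) - q\<^sup>2 * weight q d (int n))
          * (1 - t * (inverse q * inverse (weight q d (int n)))) else 0)"
      by (simp only: G_mat_def index_mat(1)[OF lt] prod.case pos of_nat_diff[OF le(1)] of_nat_diff[OF le(2)]
          weight_reflect[OF assms(1)] inverse_powi_minus power_int_of_nat power_inverse)
    then show "(Z_mat d * G_mat d (inverse q) t * Z_mat d) $$ (i, n)
        = (if i = n then weight q d (int n) else if n = i + 1 then 0 else if i = n + 1
          then (inverse (q ^ d) - q\<^sup>2 * weight q d (int n))
            * (1 - t * (inverse q * inverse (weight q d (int n)))) else 0)"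
      using flip_mat_index[OF carrier le] by simp
  next
    show "(inverse (q ^ d) - q\<^sup>2 * weight q d (- 1))
        * (1 - t * (inverse q * inverse (weight q d (- 1)))) = 0"
      unfolding weight_beyond_end[OF assms(1)] using assms(1) by (simp add: field_simps)
  qed simp
  then show ?thesis by simp
qed

lemma x01_tridiagonal:
  assumes "q \<noteq> 0" and "represents d v (Z_mat d * S_mat d (inverse q) T * Z_mat d) (gen_act 0 1)"
  shows "gen_act 0 1 (extend_by_zero d v n) =
    scale ((inverse q ^ 2 * weight q d n - q ^ d) * (inverse q * weight q d n) * T)
      (extend_by_zero d v (n - 1))
    + scale ((1 + T * (q * q ^ d + inverse (q * q ^ d))) * weight q d n
        - T * (q + inverse q) * (weight q d n)\<^sup>2) (extend_by_zero d v n)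
    + scale ((inverse (q ^ d) - q\<^sup>2 * weight q d n) * (1 - T * (q * weight q d n)))
      (extend_by_zero d v (n + 1))"
  using linear_gen_act assms(2)
proof (rule tridiagonal_action)
  fix i n assume le: "i \<le> d" "n \<le> d"
  have carrier: "S_mat d (inverse q) T \<in> carrier_mat (d + 1) (d + 1)"
    by (simp add: S_mat_def)
  have pos: "d - i = d - n \<longleftrightarrow> i = n" "d - n = d - i + 1 \<longleftrightarrow> i = n + 1" "d - i = d - n + 1 \<longleftrightarrow> n = i + 1"
    using le by auto
  have above: "inverse q ^ 2 * weight q d (int n) = weight q d (int i)"
    "inverse q * weight q d (int n) = q * weight q d (int i)" if "n = i + 1"
  proof -
    have "weight q d (int n) = q\<^sup>2 * weight q d (int i)"
      using weight_step[OF assms(1), of d "int i"] that by (simp add: add.commute)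
    then show "inverse q ^ 2 * weight q d (int n) = weight q d (int i)"
      "inverse q * weight q d (int n) = q * weight q d (int i)"
      using assms(1) by (simp_all add: field_simps power2_eq_square)
  qed
  have lt: "d - i < d + 1" "d - n < d + 1"
    by simp_all
  (* In S the subdiagonal entry is indexed by its row, so for n = i + 1 the weight at i appears first. *)
  have "S_mat d (inverse q) T $$ (d - i, d - n) =
      (if i = n then inverse (q ^ d)
          - (weight q d (int i) - q ^ d) * (q * weight q d (int i)) * T
          - (inverse (q ^ d) - weight q d (int i)) * (1 - T * (inverse q * weight q d (int i)))
       else if i = n + 1 then
         (inverse (q ^ d) - q\<^sup>2 * weight q d (int n)) * (1 - T * (q * weight q d (int n)))
       else if n = i + 1 then (weight q d (int i) - q ^ d) * (q * weight q d (int i)) * T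
       else 0)"
    by (simp only: S_mat_def index_mat(1)[OF lt] prod.case pos of_nat_diff[OF le(1)] of_nat_diff[OF le(2)]
        weight_reflect[OF assms(1)] inverse_powi_minus power_int_of_nat power_inverse)
  also have "\<dots> = (if i = n then (1 + T * (q * q ^ d + inverse (q * q ^ d))) * weight q d (int n)
          - T * (q + inverse q) * (weight q d (int n))\<^sup>2
       else if n = i + 1 then
         (inverse q ^ 2 * weight q d (int n) - q ^ d) * (inverse q * weight q d (int n)) * T
       else if i = n + 1 then
         (inverse (q ^ d) - q\<^sup>2 * weight q d (int n)) * (1 - T * (q * weight q d (int n)))
       else 0)"
    using above assms(1) by (auto simp: field_simps power2_eq_square)
  finally show "(Z_mat d * S_mat d (inverse q) T * Z_mat d) $$ (i, n) = \<dots>"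
    by (simp only: flip_mat_index[OF carrier le])
next
  show "(inverse q ^ 2 * weight q d (int d + 1) - q ^ d) * (inverse q * weight q d (int d + 1)) * T = 0"
    unfolding weight_beyond_end[OF assms(1)] using assms(1) by (simp add: field_simps)
  show "(inverse (q ^ d) - q\<^sup>2 * weight q d (- 1)) * (1 - T * (q * weight q d (- 1))) = 0"
    unfolding weight_beyond_end[OF assms(1)] using assms(1) by (simp add: field_simps)
qed

section \<open>The relations\<close>

lemma askey_wilson_x01_x23:
  assumes q: "q \<noteq> 0"
    and x01: "represents d v (Z_mat d * S_mat d (inverse q) T * Z_mat d) (gen_act 0 1)"
    and x23: "represents d v (K_mat d q) (gen_act 2 3)"
  shows "askey_wilson scale (q\<^sup>2 + inverse q ^ 2)
      (- ((q - inverse q)\<^sup>2 * (1 + T * (q * q ^ d + inverse (q * q ^ d)))))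
      ((q - inverse q) * (q\<^sup>2 - inverse q ^ 2) * T) (gen_act 0 1) (gen_act 2 3) (extend_by_zero d v n)"
    and "askey_wilson scale (q\<^sup>2 + inverse q ^ 2)
      (- ((q - inverse q)\<^sup>2 * (1 + T * (q * q ^ d + inverse (q * q ^ d)))))
      ((q - inverse q) * (q\<^sup>2 - inverse q ^ 2) * T) (gen_act 2 3) (gen_act 0 1) (extend_by_zero d v n)"
proof -
  have "((inverse (q ^ d) - q\<^sup>2 * weight q d n) * (1 - T * (q * weight q d n)))
      * ((inverse q ^ 2 * weight q d (n + 1) - q ^ d) * (inverse q * weight q d (n + 1)) * T)
    = (inverse (q ^ d) - q\<^sup>2 * weight q d n) * (weight q d n - q ^ d)
      * (1 - T * q * weight q d n) * T * q * weight q d n" for n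
  proof -
    have "inverse q ^ 2 * weight q d (n + 1) = weight q d n" "inverse q * weight q d (n + 1) = q * weight q d n"
      unfolding weight_step[OF q] using q by (simp_all add: field_simps power2_eq_square)
    then show ?thesis
      by (simp add: mult_ac)
  qed
  note * = askey_wilson_geometric_tridiagonal[OF linear_gen_act linear_gen_act
      x23_diagonal[OF x23] x01_tridiagonal[OF q x01] q _ weight_nonzero[OF q] weight_step[OF q] refl this]
  show "askey_wilson scale (q\<^sup>2 + inverse q ^ 2)
      (- ((q - inverse q)\<^sup>2 * (1 + T * (q * q ^ d + inverse (q * q ^ d)))))
      ((q - inverse q) * (q\<^sup>2 - inverse q ^ 2) * T) (gen_act 0 1) (gen_act 2 3) (extend_by_zero d v n)"
    "askey_wilson scale (q\<^sup>2 + inverse q ^ 2)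
      (- ((q - inverse q)\<^sup>2 * (1 + T * (q * q ^ d + inverse (q * q ^ d)))))
      ((q - inverse q) * (q\<^sup>2 - inverse q ^ 2) * T) (gen_act 2 3) (gen_act 0 1) (extend_by_zero d v n)"
    using q by (simp_all only: * power_not_zero simp_thms)
qed

lemma askey_wilson_x12_x30:
  assumes q: "q \<noteq> 0"
    and x12: "represents d v (E_mat d q) (gen_act 1 2)"
    and x30: "represents d v (Z_mat d * G_mat d (inverse q) t * Z_mat d) (gen_act 3 0)"
  shows "askey_wilson scale (q\<^sup>2 + inverse q ^ 2)
      (- ((q - inverse q)\<^sup>2 * (1 + t * (q * q ^ d + inverse (q * q ^ d)))))
      ((q - inverse q) * (q\<^sup>2 - inverse q ^ 2) * t) (gen_act 1 2) (gen_act 3 0) (extend_by_zero d v n)"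
  by (rule askey_wilson_geometric_bidiagonal[OF linear_gen_act linear_gen_act
      x12_bidiagonal[OF q x12] x30_bidiagonal[OF q x30] q _ weight_nonzero[OF q] weight_step[OF q]])
    (use q in \<open>simp_all add: weight_step mult_ac power_inverse\<close>)

text \<open>Read in the opposite direction, \<open>x\<^sub>3\<^sub>0\<close> lowers and \<open>x\<^sub>1\<^sub>2\<close> raises the index. The sequence of diagonal entries then has
  ratio \<open>q\<^sup>-\<^sup>2\<close>, so the bidiagonal computation applies with \<open>q\<^sup>-\<^sup>1\<close> and \<open>q\<^bsup>-d\<^esup>\<close> in place of \<open>q\<close> and \<open>q\<^sup>d\<close>, and the
  scalars of the relation are invariant under this replacement.\<close>

lemma askey_wilson_x30_x12:
  assumes q: "q \<noteq> 0"
    and x12: "represents d v (E_mat d q) (gen_act 1 2)"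
    and x30: "represents d v (Z_mat d * G_mat d (inverse q) t * Z_mat d) (gen_act 3 0)"
  shows "askey_wilson scale (q\<^sup>2 + inverse q ^ 2)
      (- ((q - inverse q)\<^sup>2 * (1 + t * (q * q ^ d + inverse (q * q ^ d)))))
      ((q - inverse q) * (q\<^sup>2 - inverse q ^ 2) * t) (gen_act 3 0) (gen_act 1 2) (extend_by_zero d v n)"
proof -
  define w where "w n = extend_by_zero d v (- n)" for n
  define \<theta> where "\<theta> n = weight q d (- n)" for n
  define e where "e n = (inverse (q ^ d) - q\<^sup>2 * \<theta> n) * (1 - t * (inverse q * inverse (\<theta> n)))" for n
  define f where "f n = q ^ d - inverse q ^ 2 * \<theta> n" for n
  have nz: "\<theta> n \<noteq> 0" for n
    using q by (simp add: \<theta>_def weight_nonzero)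
  have step: "\<theta> (n + 1) = inverse q ^ 2 * \<theta> n" for n
  proof -
    have "weight q d (- n) = q\<^sup>2 * weight q d (- n - 1)"
      using weight_step[OF q, of d "- n - 1"] by simp
    then show ?thesis
      using q by (simp add: \<theta>_def power_inverse)
  qed
  have "f n * e (n + 1) = (inverse (inverse (q ^ d)) - inverse q ^ 2 * \<theta> n) * (inverse (q ^ d) - \<theta> n)
      * (1 - t * inverse (inverse q) * inverse (\<theta> n))" for n
  proof -
    have "q\<^sup>2 * \<theta> (n + 1) = \<theta> n" "inverse q * inverse (\<theta> (n + 1)) = q * inverse (\<theta> n)"
      unfolding step using q by (simp_all add: field_simps power2_eq_square)
    then show ?thesis
      by (simp add: e_def f_def mult_ac)
  qed
  moreover have "gen_act 3 0 (w n) = scale (e n) (w (n - 1)) + scale (\<theta> n) (w n)" for n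
    using x30_bidiagonal[OF q x30, of "- n"] by (simp add: w_def \<theta>_def e_def add.commute)
  moreover have "gen_act 1 2 (w n) = scale (\<theta> n) (w n) + scale (f n) (w (n + 1))" for n
    using x12_bidiagonal[OF q x12, of "- n"] by (simp add: w_def \<theta>_def f_def)
  ultimately have "askey_wilson scale ((inverse q)\<^sup>2 + inverse (inverse q) ^ 2)
      (- ((inverse q - inverse (inverse q))\<^sup>2
        * (1 + t * (inverse q * inverse (q ^ d) + inverse (inverse q * inverse (q ^ d))))))
      ((inverse q - inverse (inverse q)) * ((inverse q)\<^sup>2 - inverse (inverse q) ^ 2) * t)
      (gen_act 3 0) (gen_act 1 2) (w (- n))"
    using q nz step
    by (intro askey_wilson_geometric_bidiagonal[where e = e and f = f and \<theta> = \<theta> and w = w] linear_gen_act) simp_all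
  moreover have "(inverse q)\<^sup>2 + inverse (inverse q) ^ 2 = q\<^sup>2 + inverse q ^ 2"
    "(inverse q - inverse (inverse q))\<^sup>2 = (q - inverse q)\<^sup>2"
    "inverse q * inverse (q ^ d) + inverse (inverse q * inverse (q ^ d)) = q * q ^ d + inverse (q * q ^ d)"
    "(inverse q - inverse (inverse q)) * ((inverse q)\<^sup>2 - inverse (inverse q) ^ 2)
      = (q - inverse q) * (q\<^sup>2 - inverse q ^ 2)"
    by (simp_all add: power2_commute algebra_simps)
  ultimately show ?thesis
    by (simp only: w_def minus_minus)
qed

lemma askey_wilson_everywhere:
  assumes "is_basis d v"
    and "\<And>n. askey_wilson scale \<beta> \<rho> \<sigma> (gen_act i j) (gen_act k l) (extend_by_zero d v n)"
  shows "askey_wilson scale \<beta> \<rho> \<sigma> (gen_act i j) (gen_act k l) x"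
proof (rule askey_wilson_span[OF linear_gen_act linear_gen_act])
  show "x \<in> span (v ` {..d})"
    using assms(1) by (simp add: is_basis_def)
  fix y assume "y \<in> v ` {..d}"
  then obtain m where "m \<le> d" "y = v m"
    by auto
  then show "askey_wilson scale \<beta> \<rho> \<sigma> (gen_act i j) (gen_act k l) y"
    using assms(2)[of "int m"] by (simp add: extend_by_zero_def)
qed

end

theorem lemma9p14:
  fixes q t :: "'f::alg_closed_field"
    and scale :: "'f \<Rightarrow> 'v::ab_group_add \<Rightarrow> 'v" (infixr "*\<^sub>V" 75)
    and act :: "'f free_alg set \<Rightarrow> 'v \<Rightarrow> 'v"
    and d :: nat
    and x01 x12 x23 x30 Ups :: "'v \<Rightarrow> 'v"
  assumes "q \<noteq> 0"
    and "\<forall>n::nat. n \<ge> 1 \<longrightarrow> q ^ n \<noteq> 1"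
    and "tet_module scale q act"
    and "tet_module.evaluation_module scale q act d"
    and "tet_module.evaluation_parameter scale q act d t"
  defines "x01 \<equiv> act (std q 0 1)"
    and "x12 \<equiv> act (std q 1 2)"
    and "x23 \<equiv> act (std q 2 3)"
    and "x30 \<equiv> act (std q 3 0)"
    and "Ups \<equiv> (\<lambda>v. (q ^ (d + 1) + inverse q ^ (d + 1)) *\<^sub>V v)"
  shows
    "(\<forall>v. x01 (x01 (x23 v)) - (q^2 + inverse q ^ 2) *\<^sub>V x01 (x23 (x01 v)) + x23 (x01 (x01 v))
        = - ((q - inverse q)^2 *\<^sub>V (x01 v + inverse t *\<^sub>V Ups (x01 v)))
          + ((q - inverse q) * (q^2 - inverse q ^ 2) * inverse t) *\<^sub>V v) \<and>
     (\<forall>v. x23 (x23 (x01 v)) - (q^2 + inverse q ^ 2) *\<^sub>V x23 (x01 (x23 v)) + x01 (x23 (x23 v))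
        = - ((q - inverse q)^2 *\<^sub>V (x23 v + inverse t *\<^sub>V Ups (x23 v)))
          + ((q - inverse q) * (q^2 - inverse q ^ 2) * inverse t) *\<^sub>V v) \<and>
     (\<forall>v. x12 (x12 (x30 v)) - (q^2 + inverse q ^ 2) *\<^sub>V x12 (x30 (x12 v)) + x30 (x12 (x12 v))
        = - ((q - inverse q)^2 *\<^sub>V (x12 v + t *\<^sub>V Ups (x12 v)))
          + ((q - inverse q) * (q^2 - inverse q ^ 2) * t) *\<^sub>V v) \<and>
     (\<forall>v. x30 (x30 (x12 v)) - (q^2 + inverse q ^ 2) *\<^sub>V x30 (x12 (x30 v)) + x12 (x30 (x30 v))
        = - ((q - inverse q)^2 *\<^sub>V (x30 v + t *\<^sub>V Ups (x30 v)))
          + ((q - inverse q) * (q^2 - inverse q ^ 2) * t) *\<^sub>V v)"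
proof -
  interpret tet_module scale q act
    by (rule assms(3))
  obtain v where basis: "is_basis d v"
    and m01: "represents d v (Z_mat d * S_mat d (inverse q) (inverse t) * Z_mat d) (gen_act 0 1)"
    and m12: "represents d v (E_mat d q) (gen_act 1 2)"
    and m23: "represents d v (K_mat d q) (gen_act 2 3)"
    and m30: "represents d v (Z_mat d * G_mat d (inverse q) t * Z_mat d) (gen_act 3 0)"
    using assms(5) unfolding evaluation_parameter_def iso_V_def by blast
  have gens: "x01 = gen_act 0 1" "x12 = gen_act 1 2" "x23 = gen_act 2 3" "x30 = gen_act 3 0"
    by (simp_all add: x01_def x12_def x23_def x30_def gen_act_def)
  have rhs: "scale (- ((q - inverse q)\<^sup>2 * (1 + T * (q * q ^ d + inverse (q * q ^ d))))) y
      = - ((q - inverse q)\<^sup>2 *\<^sub>V (y + T *\<^sub>V Ups y))" for T y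
    by (simp add: Ups_def power_inverse scale_right_distrib scale_left_distrib algebra_simps)
  note relations = askey_wilson_x01_x23[OF assms(1) m01 m23]
    askey_wilson_x12_x30[OF assms(1) m12 m30] askey_wilson_x30_x12[OF assms(1) m12 m30]
  show ?thesis
    unfolding gens
    using relations[THEN askey_wilson_everywhere[OF basis]]
    unfolding askey_wilson_def rhs by blast
qed

end
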